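(* Let $E,F$ be Banach spaces and let $\mathcal F=\{\mathbf M(X)\}_{X\in B(E,F)}$, where $\mathbf M(X)=\{T\in B(E,F): TN(X)\subset R(X)\}$. Assume that $A$ is a non-zero, double-split operator in $B(E,F)$. Then $\mathcal F$ is smoothly integrable at $A$; that is, there is a smooth ($c^\infty$) submanifold $\mathbf S$ of $B(E,F)$ with $A\in\mathbf S$ and $T_X\mathbf S=\mathbf M(X)$ for all $X\in\mathbf S$.
   Context: $B(E,F)$ is the Banach space of bounded linear operators from $E$ to $F$; $R(\cdot)$ and $N(\cdot)$ denote range and null space. $A\in B(E,F)$ is double-split if $R(A)$ is closed and there are closed subspaces $R^{+}\subset E$, $N^{+}\subset F$ with $E=N(A)\oplus R^{+}$ and $F=R(A)\oplus N^{+}$. A subset $\mathbf S$ of a Banach space $\mathbf B$ is a smooth submanifold if for each $X\in\mathbf S$ there are a closed subspace $\mathbf E_0$ of $\mathbf B$ having a closed complement, a neighborhood $\mathbf U$ of $X$ in $\mathbf B$, and a $c^\infty$ diffeomorphism $\varphi$ of $\mathbf U$ onto an open set $\varphi(\mathbf U)\subset\mathbf B$ such that $\varphi(\mathbf S\cap\mathbf U)$ is an open set in $\mathbf E_0$. The tangent space is $T_X\mathbf S=\{\dot c(0): c:(-\delta,\delta)\to\mathbf S\text{ a }c^1\text{ curve with }c(0)=X,\ \delta>0\}$. *)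

theory Defs
  imports "HOL-Analysis.Analysis"
begin

section \<open>Closed complemented subspaces and double-split operators\<close>

definition closed_complements :: "'a::real_normed_vector set \<Rightarrow> 'a set \<Rightarrow> bool" where
  "closed_complements V W \<longleftrightarrow>
     subspace V \<and> closed V \<and> subspace W \<and> closed W \<and>
     V \<inter> W = {0} \<and> {v + w |v w. v \<in> V \<and> w \<in> W} = UNIV"

definition null_space :: "('a::real_normed_vector \<Rightarrow>\<^sub>L 'b::real_normed_vector) \<Rightarrow> 'a set" where
  "null_space T = {x. blinfun_apply T x = 0}"

definition range_space :: "('a::real_normed_vector \<Rightarrow>\<^sub>L 'b::real_normed_vector) \<Rightarrow> 'b set" where
  "range_space T = range (blinfun_apply T)"

definition double_split :: "('a::banach \<Rightarrow>\<^sub>L 'b::banach) \<Rightarrow> bool" where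
  "double_split A \<longleftrightarrow>
     closed (range_space A) \<and>
     (\<exists>Rp. closed_complements (null_space A) Rp) \<and>
     (\<exists>Np. closed_complements (range_space A) Np)"

section \<open>Smooth maps between Banach spaces\<close>

text \<open>A bounded \<open>k\<close>-linear map, given as a function on lists of length \<open>k\<close>; its values on lists
  of other lengths are irrelevant.\<close>

definition bounded_multilinear ::
    "nat \<Rightarrow> ('a::real_normed_vector list \<Rightarrow> 'b::real_normed_vector) \<Rightarrow> bool" where
  "bounded_multilinear k m \<longleftrightarrow>
     (\<forall>vs i. length vs = k \<and> i < k \<longrightarrow> linear (\<lambda>v. m (vs[i := v]))) \<and>
     (\<exists>K. \<forall>vs. length vs = k \<longrightarrow> norm (m vs) \<le> K * (\<Prod>v\<leftarrow>vs. norm v))"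

text \<open>The \<open>k\<close>-th Frechet derivative takes values in \<open>L(E, L(E, \<dots> L(E, F)))\<close>, whose type depends
  on \<open>k\<close>. It is represented through the isometric identification of this space with the bounded
  \<open>k\<close>-linear maps: \<open>D k x\<close> is the \<open>k\<close>-th derivative at \<open>x\<close>, and the last conjunct says that
  \<open>h \<mapsto> D (Suc k) x (h # _)\<close> is the Frechet derivative at \<open>x\<close> of \<open>y \<mapsto> D k y\<close> with respect to the
  operator norm on \<open>k\<close>-linear maps (the estimate is uniform in \<open>vs\<close>). Continuity of every
  derivative follows from its differentiability.\<close>

definition smooth_on :: "'a::real_normed_vector set \<Rightarrow> ('a \<Rightarrow> 'b::real_normed_vector) \<Rightarrow> bool" where
  "smooth_on U f \<longleftrightarrow> open U \<and>
     (\<exists>D :: nat \<Rightarrow> 'a \<Rightarrow> 'a list \<Rightarrow> 'b.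
        (\<forall>x\<in>U. D 0 x [] = f x) \<and>
        (\<forall>k. \<forall>x\<in>U. bounded_multilinear k (D k x)) \<and>
        (\<forall>k. \<forall>x\<in>U. \<forall>e>0. \<forall>\<^sub>F y in at x. \<forall>vs. length vs = k \<longrightarrow>
           norm (D k y vs - D k x vs - D (Suc k) x ((y - x) # vs))
             \<le> e * norm (y - x) * (\<Prod>v\<leftarrow>vs. norm v)))"

definition smooth_diffeo_on ::
    "'a::real_normed_vector set \<Rightarrow> ('a \<Rightarrow> 'b::real_normed_vector) \<Rightarrow> bool" where
  "smooth_diffeo_on U \<phi> \<longleftrightarrow>
     open (\<phi> ` U) \<and> inj_on \<phi> U \<and> smooth_on U \<phi> \<and> smooth_on (\<phi> ` U) (inv_into U \<phi>)"

section \<open>Submanifolds, tangent spaces and integrability\<close>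

definition smooth_submanifold :: "'a::banach set \<Rightarrow> bool" where
  "smooth_submanifold S \<longleftrightarrow>
     (\<forall>X\<in>S. \<exists>E0 U \<phi>. (\<exists>E1. closed_complements E0 E1) \<and>
        open U \<and> X \<in> U \<and> smooth_diffeo_on U (\<phi> :: 'a \<Rightarrow> 'a) \<and>
        openin (top_of_set E0) (\<phi> ` (S \<inter> U)))"

definition tangent_space :: "'a::banach set \<Rightarrow> 'a \<Rightarrow> 'a set" where
  "tangent_space S X =
     {vector_derivative c (at 0) |c \<delta>. \<delta> > 0 \<and> c C1_differentiable_on {-\<delta><..<\<delta>} \<and>
        c ` {-\<delta><..<\<delta>} \<subseteq> S \<and> c 0 = X}"

definition smoothly_integrable_at :: "('a::banach \<Rightarrow> 'a set) \<Rightarrow> 'a \<Rightarrow> bool" where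
  "smoothly_integrable_at M A \<longleftrightarrow>
     (\<exists>S. smooth_submanifold S \<and> A \<in> S \<and> (\<forall>X\<in>S. tangent_space S X = M X))"

definition operator_family :: "('a::banach \<Rightarrow>\<^sub>L 'b::banach) \<Rightarrow> ('a \<Rightarrow>\<^sub>L 'b) set" where
  "operator_family X = {T. blinfun_apply T ` null_space X \<subseteq> range_space X}"

end

theory Submission
  imports Defs
begin

text \<open>
  The manifold is cut out near \<open>A\<close> by the vanishing of a Schur complement. Double-splitness
  provides a bounded generalized inverse \<open>B\<close> of \<open>A\<close> (\<open>A B A = A\<close>, \<open>B A B = B\<close>), hence
  decompositions \<open>E = R(B) \<oplus> N(A)\<close> and \<open>F = R(A) \<oplus> N(B)\<close>, in which every operator \<open>T\<close> is a
  block matrix with entries \<open>T\<^sub>1\<^sub>1, T\<^sub>1\<^sub>2, T\<^sub>2\<^sub>1, T\<^sub>2\<^sub>2\<close> and \<open>A\<close> has only the invertible entry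
  \<open>A\<^sub>1\<^sub>1\<close>. On the open set where \<open>norm (B (T - A)) < 1\<close> the entry \<open>T\<^sub>1\<^sub>1\<close> stays invertible, and
  \<open>S\<close> is the set of those \<open>T\<close> whose Schur complement \<open>h T = T\<^sub>2\<^sub>2 - T\<^sub>2\<^sub>1 T\<^sub>1\<^sub>1\<^sup>-\<^sup>1 T\<^sub>1\<^sub>2\<close> is zero.

  Two properties of \<open>h\<close> carry the geometry. It takes values in the (2,2) corner, and adding an
  operator \<open>D\<close> concentrated in that corner changes \<open>h\<close> by exactly \<open>D\<close>. Consequently \<open>S\<close> is the
  graph of a function over the complement of the corner: replacing \<open>T\<^sub>2\<^sub>2\<close> by \<open>h T\<close> is a single
  chart for \<open>S\<close>, whose inverse replaces \<open>T\<^sub>2\<^sub>2\<close> by \<open>T\<^sub>2\<^sub>2 + T\<^sub>2\<^sub>1 T\<^sub>1\<^sub>1\<^sup>-\<^sup>1 T\<^sub>1\<^sub>2\<close>. Moreover \<open>T \<mapsto> T - h T\<close>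
  retracts the whole neighbourhood onto \<open>S\<close>, so for \<open>H\<close> in the kernel of \<open>h' X\<close> the retraction
  of the segment \<open>X + t H\<close> is a curve in \<open>S\<close> with velocity \<open>H\<close>; thus \<open>T\<^sub>X S\<close> is the kernel of
  \<open>h' X\<close> (\<open>vertical_function.smooth_submanifold_zeros\<close>,
  \<open>vertical_function.tangent_space_zeros\<close>).

  The kernel is found by computing \<open>N(X)\<close> and \<open>R(X)\<close> for \<open>X \<in> S\<close>. With \<open>Z = 1 + B (X - A)\<close> one
  gets \<open>N(X) = Z\<^sup>-\<^sup>1 N(A)\<close>, while \<open>y \<in> R(X)\<close> means that \<open>y\<close> and \<open>X Z\<^sup>-\<^sup>1 B y\<close> agree modulo \<open>R(A)\<close>.
  Since \<open>h T = Q T Z\<^sup>-\<^sup>1 P\<close>, with \<open>Z\<close> formed from \<open>T\<close>, for the projections \<open>P = 1 - B A\<close>, \<open>Q = 1 - A B\<close>, its derivative at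
  \<open>X\<close> is \<open>h' X H = Q (H - X Z\<^sup>-\<^sup>1 B H) Z\<^sup>-\<^sup>1 P\<close>, and its vanishing says literally that \<open>H\<close> maps
  \<open>N(X)\<close> into \<open>R(X)\<close>.

  Two analytic ingredients enter. Boundedness of \<open>B\<close> comes from the
  closed graph theorem, and smoothness of \<open>h\<close> from that of the inverse \<open>R\<close> of an affine
  operator-valued function with linear part \<open>L\<close>, whose \<open>k\<close>-th derivative is the sum, over all
  orderings of the directions, of the words \<open>(-1)\<^sup>k R L(u\<^sub>1) R L(u\<^sub>2) R \<dots> L(u\<^sub>k) R\<close>. The product
  \<open>T Z\<^sup>-\<^sup>1\<close> in \<open>h\<close> is covered by the same result, because it is, up to a summand
  killed by \<open>Q\<close>, an entry of the inverse of an affine block operator on \<open>F \<times> E\<close>.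
\<close>

section \<open>The closed graph theorem and generalized inverses\<close>

text \<open>By Baire's theorem some closure of a sublevel set of \<open>norm \<circ> G\<close> contains a ball, so up to an error
of half its norm every \<open>x\<close> can be approximated by some \<open>y\<close> with \<open>G y\<close> controlled. Iterating on the
error writes \<open>x\<close> as a series whose image series converges absolutely; closedness of the graph
identifies the sum of the images with \<open>G x\<close>.\<close>

lemma closed_graph_theorem:
  fixes G :: "'a::banach \<Rightarrow> 'b::banach"
  assumes lin: "linear G" and graph: "closed {(x, G x) |x. True}"
  shows "bounded_linear G"
proof -
  interpret G: linear G by fact
  define C where "C n = closure {x. norm (G x) \<le> real n}" for n
  have "\<Union>(range C) = UNIV"
  proof -
    have "x \<in> C (nat \<lceil>norm (G x)\<rceil>)" for x
      unfolding C_def by (rule subsetD[OF closure_subset]) (simp add: real_nat_ceiling_ge)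
    then show ?thesis by blast
  qed
  then have "\<exists>n. interior (C n) \<noteq> {}"
    using Baire_category_alt[of "euclidean :: 'a topology" "range C"] completely_metrizable_space_euclidean
    by (auto simp: C_def)
  then obtain n x0 r where r: "r > 0" "ball x0 r \<subseteq> C n"
    by (meson ex_in_conv mem_interior)
  define M where "M = 4 * real n / r"
  have approx: "\<exists>y. norm (x - y) \<le> norm x / 2 \<and> norm (G y) \<le> M * norm x" for x
  proof (cases "x = 0")
    case True
    then show ?thesis by (intro exI[of _ 0]) (simp add: G.zero)
  next
    case False
    \<comment> \<open>With this scaling both the centre and its translate by a multiple of x lie in the ball, and x is a rescaled difference of the two.\<close>
    define s where "s = r / (2 * norm x)"
    have s: "s > 0" using False r by (simp add: s_def)
    have "x0 + s *\<^sub>R x \<in> C n" "x0 \<in> C n"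
      using r False by (intro subsetD[OF r(2)]; simp add: dist_norm s_def)+
    moreover have "s * norm x / 4 > 0" using s False by simp
    ultimately obtain a b where ab: "norm (G a) \<le> n" "norm (G b) \<le> n"
        "dist a (x0 + s *\<^sub>R x) < s * norm x / 4" "dist b x0 < s * norm x / 4"
      unfolding C_def closure_approachable by blast
    define y where "y = (a - b) /\<^sub>R s"
    have "x - y = ((x0 + s *\<^sub>R x - a) - (x0 - b)) /\<^sub>R s"
      using s by (simp add: y_def algebra_simps)
    then have "norm (x - y) = norm ((x0 + s *\<^sub>R x - a) - (x0 - b)) / s"
      using s by (simp add: divide_inverse_commute)
    also have "\<dots> \<le> (s * norm x / 4 + s * norm x / 4) / s"
      using ab(3,4) s norm_triangle_ineq4[of "x0 + s *\<^sub>R x - a" "x0 - b"]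
      by (intro divide_right_mono) (auto simp: dist_norm norm_minus_commute)
    finally have 1: "norm (x - y) \<le> norm x / 2" using s by (simp add: field_simps)
    have "norm (G y) = norm (G a - G b) / s"
      using s by (simp add: y_def G.scaleR G.diff divide_inverse_commute)
    also have "\<dots> \<le> (n + n) / s"
      using ab(1,2) s norm_triangle_ineq4[of "G a" "G b"] by (intro divide_right_mono) auto
    also have "\<dots> = M * norm x" using r False by (simp add: s_def M_def field_simps)
    finally show ?thesis using 1 by blast
  qed
  have M0: "M \<ge> 0" using r by (simp add: M_def)
  obtain y where y: "\<And>x. norm (x - y x) \<le> norm x / 2" "\<And>x. norm (G (y x)) \<le> M * norm x"
    using approx by metis
  have "norm (G x) \<le> norm x * (2 * M)" for x
  proof -
    \<comment> \<open>The error left after k approximation steps.\<close>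
    define s where "s k = ((\<lambda>x. x - y x) ^^ k) x" for k
    have s_Suc: "s (Suc k) = s k - y (s k)" for k by (simp add: s_def)
    have s_le: "norm (s k) \<le> norm x * (1/2)^k" for k
    proof (induction k)
      case (Suc k)
      then show ?case using y(1)[of "s k"] by (simp add: s_Suc)
    qed (simp add: s_def)
    have "(\<lambda>k. norm x * (1/2)^k) \<longlonglongrightarrow> norm x * 0"
      by (intro tendsto_intros LIMSEQ_power_zero) simp
    then have "s \<longlonglongrightarrow> 0"
      using s_le by (intro Lim_null_comparison[of s]) auto
    then have lim: "(\<lambda>k. x - s k) \<longlonglongrightarrow> x - 0" by (intro tendsto_intros)
    have Gs: "G (x - s k) = (\<Sum>j<k. G (y (s j)))" for k
    proof (induction k)
      case (Suc k)
      then show ?case by (simp add: s_Suc G.diff G.add algebra_simps)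
    qed (simp add: s_def G.zero)
    have le: "norm (G (y (s k))) \<le> M * norm x * (1/2)^k" for k
      using y(2)[of "s k"] mult_left_mono[OF s_le[of k] M0] by (simp add: mult.assoc)
    have geo: "(\<lambda>k. M * norm x * (1/2)^k) sums (M * norm x * 2)"
      using sums_mult[OF geometric_sums[of "1/2::real"], of "M * norm x"] by simp
    have sm: "summable (\<lambda>k. norm (G (y (s k))))"
      using le by (intro summable_comparison_test[OF _ sums_summable[OF geo]]) auto
    have "(\<lambda>k. G (x - s k)) \<longlonglongrightarrow> (\<Sum>k. G (y (s k)))"
      unfolding Gs using summable_LIMSEQ summable_norm_cancel[OF sm] by blast
    then have "(\<lambda>k. (x - s k, G (x - s k))) \<longlonglongrightarrow> (x, \<Sum>k. G (y (s k)))"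
      using lim by (intro tendsto_Pair) auto
    then have "(x, \<Sum>k. G (y (s k))) \<in> {(x, G x) |x. True}"
      by (rule closed_sequentially[OF graph, rotated]) auto
    then have "G x = (\<Sum>k. G (y (s k)))" by simp
    also have "norm \<dots> \<le> (\<Sum>k. norm (G (y (s k))))" by (rule summable_norm[OF sm])
    also have "\<dots> \<le> M * norm x * 2"
      using suminf_le[OF le sm sums_summable[OF geo]] sums_unique[OF geo] by simp
    finally show ?thesis by (simp add: mult_ac)
  qed
  then show ?thesis
    using lin by (intro bounded_linear.intro bounded_linear_axioms.intro exI[of _ "2 * M"]) auto
qed

text \<open>The generalized inverse sends \<open>y\<close> to the point of the complement \<open>V\<close> of \<open>N(A)\<close> whose image is the
\<open>R(A)\<close>-component of \<open>y\<close>. Described as the unique \<open>r \<in> V\<close> with \<open>y - A r \<in> W\<close>, it visibly has a closed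
graph, because \<open>V\<close> and \<open>W\<close> are closed.\<close>

lemma double_split_generalized_inverse:
  fixes A :: "'a::banach \<Rightarrow>\<^sub>L 'b::banach"
  assumes "double_split A"
  obtains B :: "'b \<Rightarrow>\<^sub>L 'a" where "A o\<^sub>L B o\<^sub>L A = A" "B o\<^sub>L A o\<^sub>L B = B"
proof -
  obtain V W where V: "closed_complements (null_space A) V"
    and W: "closed_complements (range_space A) W"
    using assms unfolding double_split_def by blast
  have subV: "subspace V" and cV: "closed V" and subW: "subspace W" and cW: "closed W"
    using V W by (auto simp: closed_complements_def)
  have ex: "\<exists>r\<in>V. y - A r \<in> W" for y
  proof -
    obtain z w where w: "y = A z + w" "w \<in> W"
      using W unfolding closed_complements_def range_space_def by (auto, blast)
    moreover obtain n r where "z = n + r" "A n = 0" "r \<in> V"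
      using V unfolding closed_complements_def null_space_def by (auto, blast)
    ultimately show ?thesis by (intro bexI[of _ r]) (simp_all add: blinfun.add_right)
  qed
  have uniq: "r = r'" if "r \<in> V" "r' \<in> V" "y - A r \<in> W" "y - A r' \<in> W" for y r r'
  proof -
    have "A (r' - r) \<in> W" "r' - r \<in> V"
      using subspace_diff[OF subW that(3,4)] subspace_diff[OF subV that(2,1)]
      by (auto simp: blinfun.bilinear_simps)
    moreover from this(1) have "A (r' - r) = 0"
      using W unfolding closed_complements_def range_space_def by blast
    ultimately have "r' - r = 0"
      using V unfolding closed_complements_def null_space_def by blast
    then show ?thesis by simp
  qed
  obtain G where G: "G y \<in> V" "y - A (G y) \<in> W" for y using ex by metis
  have G_eq: "G y = r" if "r \<in> V" "y - A r \<in> W" for y r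
    using uniq G that by blast
  have "linear G"
  proof
    fix x y c
    show "G (x + y) = G x + G y"
      using G[of x] G[of y] subspace_add[OF subW G(2)[of x] G(2)[of y]]
      by (intro G_eq) (auto simp: blinfun.bilinear_simps algebra_simps subspace_add[OF subV])
    show "G (c *\<^sub>R x) = c *\<^sub>R G x"
      using subspace_scale[OF subW G(2)[of x], of c] subspace_scale[OF subV G(1)[of x], of c]
      by (intro G_eq) (auto simp: blinfun.bilinear_simps algebra_simps)
  qed
  moreover have "{(y, G y) |y. True} = (UNIV \<times> V) \<inter> (\<lambda>p. fst p - A (snd p)) -` W"
    using G G_eq by (fastforce intro: sym)
  then have "closed {(y, G y) |y. True}"
    by (auto intro!: closed_Int closed_Times closed_vimage continuous_intros cV cW)
  ultimately have bl: "bounded_linear G" by (rule closed_graph_theorem)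
  have "G (A x) \<in> V \<and> A (G (A x)) = A x" for x
  proof -
    have "A (x - G (A x)) \<in> W" using G(2)[of "A x"] by (simp add: blinfun.bilinear_simps)
    then have "A (x - G (A x)) = 0"
      using W unfolding closed_complements_def range_space_def by blast
    then show ?thesis using G(1) by (simp add: blinfun.bilinear_simps)
  qed
  moreover have "G (A (G y)) = G y" for y
    using G(1) subspace_0[OF subW] by (intro G_eq) auto
  ultimately show thesis
    by (intro that[of "Blinfun G"]) (auto intro!: blinfun_eqI simp: bounded_linear_Blinfun_apply[OF bl])
qed

text \<open>Solving \<open>x + K x = y\<close> is a fixed point problem for the contraction \<open>x \<mapsto> y - K x\<close>.\<close>

lemma inverse_near_identity:
  fixes K :: "'a::banach \<Rightarrow>\<^sub>L 'a"
  assumes "norm K < 1"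
  obtains R where "R o\<^sub>L (id_blinfun + K) = id_blinfun" "(id_blinfun + K) o\<^sub>L R = id_blinfun"
proof -
  have "\<exists>!x. y - K x = x" for y
  proof (rule banach_fix_type)
    show "\<forall>x x'. dist (y - K x) (y - K x') \<le> norm K * dist x x'"
      using norm_blinfun[of K] by (auto simp: dist_norm simp flip: blinfun.diff_right) (metis norm_minus_commute)
  qed (use assms in auto)
  then obtain G where G: "y - K (G y) = G y" and uniq: "\<And>x. y - K x = x \<Longrightarrow> G y = x" for y
    by metis
  have "bounded_linear G"
  proof (rule bounded_linear_intro)
    fix x y c
    show "G (x + y) = G x + G y"
      using G[of x] G[of y] by (intro uniq) (simp add: blinfun.bilinear_simps algebra_simps)
    have "c *\<^sub>R (x - K (G x)) = c *\<^sub>R G x" by (simp only: G)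
    then show "G (c *\<^sub>R x) = c *\<^sub>R G x"
      by (intro uniq) (simp add: blinfun.bilinear_simps algebra_simps)
    have "norm (G x) \<le> norm x + norm (K (G x))"
      using norm_triangle_ineq4[of x "K (G x)"] by (simp add: G)
    also have "\<dots> \<le> norm x + norm K * norm (G x)" using norm_blinfun[of K "G x"] by simp
    finally show "norm (G x) \<le> norm x * (1 / (1 - norm K))"
      using assms by (simp add: field_simps)
  qed
  moreover have "G (x + K x) = x" for x by (intro uniq) simp
  moreover have "G y + K (G y) = y" for y using G[of y] by (simp add: algebra_simps)
  ultimately show thesis
    by (intro that[of "Blinfun G"])
      (auto intro!: blinfun_eqI simp: bounded_linear_Blinfun_apply blinfun.bilinear_simps)
qed

section \<open>Elementary smooth maps\<close>

lemma smooth_on_cong: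
  assumes "smooth_on U f" "\<And>x. x \<in> U \<Longrightarrow> g x = f x"
  shows "smooth_on U g"
  using assms unfolding smooth_on_def by (simp cong: ball_cong)

lemma bounded_linear_compose_multilinear:
  assumes T: "bounded_linear T" and m: "bounded_multilinear k m"
  shows "bounded_multilinear k (\<lambda>vs. T (m vs))"
proof -
  obtain K where K: "\<And>vs. length vs = k \<Longrightarrow> norm (m vs) \<le> K * (\<Prod>v\<leftarrow>vs. norm v)"
    using m unfolding bounded_multilinear_def by blast
  obtain C where C: "C \<ge> 0" "\<And>x. norm (T x) \<le> norm x * C"
    using bounded_linear.nonneg_bounded[OF T] by blast
  have "norm (T (m vs)) \<le> (K * C) * (\<Prod>v\<leftarrow>vs. norm v)" if "length vs = k" for vs
    using C(2)[of "m vs"] mult_right_mono[OF K[OF that] C(1)] by (simp add: mult_ac)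
  moreover have "linear (\<lambda>v. T (m (vs[i := v])))" if "length vs = k" "i < k" for vs i
    using linear_compose[of "\<lambda>v. m (vs[i := v])" T] m that bounded_linear.linear[OF T]
    unfolding bounded_multilinear_def o_def by blast
  ultimately show ?thesis unfolding bounded_multilinear_def by blast
qed

lemma smooth_on_bounded_linear_compose:
  fixes f :: "'a::real_normed_vector \<Rightarrow> 'b::real_normed_vector"
  assumes T: "bounded_linear T" and f: "smooth_on U f"
  shows "smooth_on U (\<lambda>x. T (f x))"
proof -
  obtain D :: "nat \<Rightarrow> 'a \<Rightarrow> 'a list \<Rightarrow> 'b" where U: "open U" and D0: "\<And>x. x \<in> U \<Longrightarrow> D 0 x [] = f x"
    and D1: "\<And>k x. x \<in> U \<Longrightarrow> bounded_multilinear k (D k x)"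
    and D2: "\<And>k x e. x \<in> U \<Longrightarrow> e > 0 \<Longrightarrow> \<forall>\<^sub>F y in at x. \<forall>vs. length vs = k \<longrightarrow>
           norm (D k y vs - D k x vs - D (Suc k) x ((y - x) # vs))
             \<le> e * norm (y - x) * (\<Prod>v\<leftarrow>vs. norm v)"
    using f unfolding smooth_on_def by blast
  obtain C where C: "C > 0" "\<And>x. norm (T x) \<le> norm x * C"
    using bounded_linear.pos_bounded[OF T] by blast
  interpret T: bounded_linear T by fact
  have "\<forall>\<^sub>F y in at x. \<forall>vs. length vs = k \<longrightarrow>
           norm (T (D k y vs) - T (D k x vs) - T (D (Suc k) x ((y - x) # vs)))
             \<le> e * norm (y - x) * (\<Prod>v\<leftarrow>vs. norm v)" if x: "x \<in> U" and e: "e > 0" for x k e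
  proof -
    have "e / C > 0" using e C by simp
    from D2[OF x this, of k] show ?thesis
    proof eventually_elim
      case (elim y)
      show ?case
      proof (intro allI impI)
        fix vs :: "'a list" assume "length vs = k"
        with elim have "norm (D k y vs - D k x vs - D (Suc k) x ((y - x) # vs)) * C
             \<le> (e / C * norm (y - x) * (\<Prod>v\<leftarrow>vs. norm v)) * C"
          using C by (intro mult_right_mono) auto
        then show "norm (T (D k y vs) - T (D k x vs) - T (D (Suc k) x ((y - x) # vs)))
             \<le> e * norm (y - x) * (\<Prod>v\<leftarrow>vs. norm v)"
          using C(2)[of "D k y vs - D k x vs - D (Suc k) x ((y - x) # vs)"] C(1)
          by (simp add: T.diff)
      qed
    qed
  qed
  then show ?thesis
    unfolding smooth_on_def using U D0 bounded_linear_compose_multilinear[OF T D1]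
    by (intro conjI exI[of _ "\<lambda>k x vs. T (D k x vs)"]) auto
qed

lemma smooth_on_bounded_linear:
  fixes T :: "'a::real_normed_vector \<Rightarrow> 'b::real_normed_vector"
  assumes T: "bounded_linear T" and U: "open U"
  shows "smooth_on U T"
proof -
  interpret T: bounded_linear T by fact
  \<comment> \<open>The first derivative is T itself, in every point, and all higher ones vanish.\<close>
  define D where "D k x vs = (if k = 0 then T x else if k = 1 then T (hd vs) else 0)"
    for k :: nat and x vs
  obtain C where C: "C \<ge> 0" "\<And>x. norm (T x) \<le> norm x * C"
    using T.nonneg_bounded by blast
  have "bounded_multilinear k (D k x)" for k x
  proof -
    have "\<exists>K. \<forall>vs. length vs = k \<longrightarrow> norm (D k x vs) \<le> K * (\<Prod>v\<leftarrow>vs. norm v)"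
    proof -
      consider "k = 0" | "k = 1" | "k > 1" by linarith
      then show ?thesis
      proof cases
        case 1 then show ?thesis by (auto simp: D_def)
      next
        case 2
        then show ?thesis using C
          by (intro exI[of _ C]) (auto simp: D_def length_Suc_conv mult.commute)
      next
        case 3 then show ?thesis by (intro exI[of _ 0]) (auto simp: D_def)
      qed
    qed
    moreover have "linear (\<lambda>v. D k x (vs[i := v]))" if "length vs = k" "i < k" for vs i
      using that T.linear by (auto simp: D_def length_Suc_conv linear_iff)
    ultimately show ?thesis unfolding bounded_multilinear_def by blast
  qed
  moreover have "norm (D k y vs - D k x vs - D (Suc k) x ((y - x) # vs)) = 0" for k x y vs
    by (auto simp: D_def T.diff)
  moreover have "0 \<le> (\<Prod>v\<leftarrow>vs. norm v)" for vs :: "'a list" by (induction vs) auto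
  ultimately show ?thesis
    unfolding smooth_on_def using U by (intro conjI exI[of _ D]) (auto simp: D_def)
qed

lemma smooth_on_add:
  fixes f g :: "'a::real_normed_vector \<Rightarrow> 'b::real_normed_vector"
  assumes "smooth_on U f" "smooth_on U g"
  shows "smooth_on U (\<lambda>x. f x + g x)"
proof -
  obtain D :: "nat \<Rightarrow> 'a \<Rightarrow> 'a list \<Rightarrow> 'b" where U: "open U" and D0: "\<And>x. x \<in> U \<Longrightarrow> D 0 x [] = f x"
    and D1: "\<And>k x. x \<in> U \<Longrightarrow> bounded_multilinear k (D k x)"
    and D2: "\<And>k x e. x \<in> U \<Longrightarrow> e > 0 \<Longrightarrow> \<forall>\<^sub>F y in at x. \<forall>vs. length vs = k \<longrightarrow>
           norm (D k y vs - D k x vs - D (Suc k) x ((y - x) # vs))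
             \<le> e * norm (y - x) * (\<Prod>v\<leftarrow>vs. norm v)"
    using assms(1) unfolding smooth_on_def by blast
  obtain E :: "nat \<Rightarrow> 'a \<Rightarrow> 'a list \<Rightarrow> 'b" where E0: "\<And>x. x \<in> U \<Longrightarrow> E 0 x [] = g x"
    and E1: "\<And>k x. x \<in> U \<Longrightarrow> bounded_multilinear k (E k x)"
    and E2: "\<And>k x e. x \<in> U \<Longrightarrow> e > 0 \<Longrightarrow> \<forall>\<^sub>F y in at x. \<forall>vs. length vs = k \<longrightarrow>
           norm (E k y vs - E k x vs - E (Suc k) x ((y - x) # vs))
             \<le> e * norm (y - x) * (\<Prod>v\<leftarrow>vs. norm v)"
    using assms(2) unfolding smooth_on_def by blast
  have "bounded_multilinear k (\<lambda>vs. D k x vs + E k x vs)" if "x \<in> U" for k x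
  proof -
    obtain K where K: "\<And>vs. length vs = k \<Longrightarrow> norm (D k x vs) \<le> K * (\<Prod>v\<leftarrow>vs. norm v)"
      using D1[OF \<open>x \<in> U\<close>, of k] unfolding bounded_multilinear_def by blast
    obtain L where L: "\<And>vs. length vs = k \<Longrightarrow> norm (E k x vs) \<le> L * (\<Prod>v\<leftarrow>vs. norm v)"
      using E1[OF \<open>x \<in> U\<close>, of k] unfolding bounded_multilinear_def by blast
    have "norm (D k x vs + E k x vs) \<le> (K + L) * (\<Prod>v\<leftarrow>vs. norm v)" if "length vs = k" for vs
      using norm_triangle_ineq[of "D k x vs" "E k x vs"] K[OF that] L[OF that]
      by (simp add: distrib_right)
    moreover have "linear (\<lambda>v. D k x (vs[i := v]) + E k x (vs[i := v]))"
      if "length vs = k" "i < k" for vs i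
      using D1[OF \<open>x \<in> U\<close>, of k] E1[OF \<open>x \<in> U\<close>, of k] that
      unfolding bounded_multilinear_def by (intro linear_compose_add) auto
    ultimately show ?thesis unfolding bounded_multilinear_def by blast
  qed
  moreover have "\<forall>\<^sub>F y in at x. \<forall>vs. length vs = k \<longrightarrow>
           norm ((D k y vs + E k y vs) - (D k x vs + E k x vs)
               - (D (Suc k) x ((y - x) # vs) + E (Suc k) x ((y - x) # vs)))
             \<le> e * norm (y - x) * (\<Prod>v\<leftarrow>vs. norm v)" if x: "x \<in> U" and e: "e > 0" for x k e
  proof -
    have "e / 2 > 0" using e by simp
    from D2[OF x this, of k] E2[OF x this, of k] show ?thesis
    proof eventually_elim
      case (elim y)
      show ?case
      proof (intro allI impI)
        fix vs :: "'a list" assume "length vs = k"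
        with elim have "norm (D k y vs - D k x vs - D (Suc k) x ((y - x) # vs))
            + norm (E k y vs - E k x vs - E (Suc k) x ((y - x) # vs))
             \<le> e * norm (y - x) * (\<Prod>v\<leftarrow>vs. norm v)"
          by fastforce
        then show "norm ((D k y vs + E k y vs) - (D k x vs + E k x vs)
               - (D (Suc k) x ((y - x) # vs) + E (Suc k) x ((y - x) # vs)))
             \<le> e * norm (y - x) * (\<Prod>v\<leftarrow>vs. norm v)"
          using norm_triangle_ineq[of "D k y vs - D k x vs - D (Suc k) x ((y - x) # vs)"
              "E k y vs - E k x vs - E (Suc k) x ((y - x) # vs)"]
          by (simp add: algebra_simps)
      qed
    qed
  qed
  ultimately show ?thesis
    unfolding smooth_on_def using U D0 E0
    by (intro conjI exI[of _ "\<lambda>k x vs. D k x vs + E k x vs"]) auto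
qed

section \<open>Sums over orderings of a list of directions\<close>

text \<open>The sum of \<open>G\<close> over the lists obtained by inserting \<open>v\<close> into \<open>us\<close> at any position. By Leibniz' rule
and \<open>R' v = - R (L v) R\<close>, this describes, up to sign, what differentiating an alternating word in \<open>R\<close>
and \<open>L u\<close> in direction \<open>v\<close> does: every factor \<open>R\<close> in turn is split by a new letter \<open>v\<close>.\<close>

primrec ins_sum :: "'v \<Rightarrow> 'v list \<Rightarrow> ('v list \<Rightarrow> 'b) \<Rightarrow> 'b::real_normed_vector" where
  "ins_sum v [] G = G [v]"
| "ins_sum v (u # us) G = G (v # u # us) + ins_sum v us (\<lambda>ws. G (u # ws))"

text \<open>The sum of \<open>G\<close> over all \<open>(length vs)!\<close> rearrangements of \<open>vs\<close>, counted by position. Generating them by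
successive insertions, rather than by permutations, makes \<open>sym_sum (v # vs) G\<close> the same sum over
\<open>vs\<close> of the insertion sums of \<open>G\<close>; this is exactly the passage from the \<open>k\<close>-th to the next derivative,
with the new direction at the head of the list.\<close>

primrec sym_sum :: "'v list \<Rightarrow> ('v list \<Rightarrow> 'b) \<Rightarrow> 'b::real_normed_vector" where
  "sym_sum [] G = G []"
| "sym_sum (v # vs) G = sym_sum vs (\<lambda>us. ins_sum v us G)"

lemma prod_list_norm_nonneg: "0 \<le> (\<Prod>v\<leftarrow>vs. norm v)"
  by (induction vs) auto

lemma linear_ins_sum_family:
  assumes "\<And>ws. length ws = Suc (length us) \<Longrightarrow> linear (\<lambda>z. H z ws)"
  shows "linear (\<lambda>z. ins_sum v us (H z))"
  using assms
proof (induction us arbitrary: H)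
  case (Cons u us)
  show ?case using Cons.prems Cons.IH[of "\<lambda>z ws. H z (u # ws)"]
    by (auto intro!: linear_compose_add)
qed auto

lemma linear_sym_sum_family:
  assumes "\<And>ws. length ws = length vs \<Longrightarrow> linear (\<lambda>z. H z ws)"
  shows "linear (\<lambda>z. sym_sum vs (H z))"
  using assms
proof (induction vs arbitrary: H)
  case (Cons v vs)
  have "linear (\<lambda>z. sym_sum vs (\<lambda>us. ins_sum v us (H z)))"
    using Cons.prems by (intro Cons.IH linear_ins_sum_family) auto
  then show ?case by simp
qed auto

text \<open>Used to pull the first letters of a word out of an insertion sum.\<close>

lemma ins_sum_linear: "linear T \<Longrightarrow> ins_sum v us (\<lambda>ws. T (G ws)) = T (ins_sum v us G)"
  by (induction us arbitrary: G) (auto simp: linear_add)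

lemma sym_sum_diff:
  fixes G H :: "'v list \<Rightarrow> 'b::real_normed_vector"
  shows "sym_sum vs (\<lambda>us. G us - H us) = sym_sum vs G - sym_sum vs H"
proof (induction vs arbitrary: G H)
  case (Cons v vs)
  have "ins_sum v us (\<lambda>us. G us - H us) = ins_sum v us G - ins_sum v us H" for us and G H :: "'v list \<Rightarrow> 'b"
    by (induction us arbitrary: G H) auto
  then show ?case using Cons.IH by simp
qed simp

lemma norm_ins_sum_le:
  assumes "\<And>ws. length ws = Suc (length us) \<Longrightarrow> norm (G ws) \<le> c * (\<Prod>v\<leftarrow>ws. norm v)"
  shows "norm (ins_sum v us G) \<le> real (Suc (length us)) * c * (norm v * (\<Prod>v\<leftarrow>us. norm v))"
  using assms
proof (induction us arbitrary: G c)
  case (Cons u us)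
  have "norm (ins_sum v us (\<lambda>ws. G (u # ws)))
      \<le> real (Suc (length us)) * (c * norm u) * (norm v * (\<Prod>v\<leftarrow>us. norm v))"
    using Cons.prems[of "u # _"] by (intro Cons.IH) (simp add: mult.assoc)
  moreover have "norm (G (v # u # us)) \<le> c * (norm v * (norm u * (\<Prod>v\<leftarrow>us. norm v)))"
    using Cons.prems[of "v # u # us"] by simp
  ultimately show ?case
    using norm_triangle_ineq[of "G (v # u # us)" "ins_sum v us (\<lambda>ws. G (u # ws))"]
    by (simp add: algebra_simps)
qed (use assms[of "[v]"] in \<open>auto dest: meta_spec[of _ "[v]"]\<close>)

lemma norm_sym_sum_le:
  assumes "\<And>ws. length ws = length vs \<Longrightarrow> norm (G ws) \<le> c * (\<Prod>v\<leftarrow>ws. norm v)"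
  shows "norm (sym_sum vs G) \<le> fact (length vs) * c * (\<Prod>v\<leftarrow>vs. norm v)"
  using assms
proof (induction vs arbitrary: G c)
  case (Cons v vs)
  have "norm (sym_sum vs (\<lambda>us. ins_sum v us G))
      \<le> fact (length vs) * (real (Suc (length vs)) * c * norm v) * (\<Prod>v\<leftarrow>vs. norm v)"
  proof (rule Cons.IH)
    fix ws :: "'a list" assume len: "length ws = length vs"
    have "norm (ins_sum v ws G) \<le> real (Suc (length ws)) * c * (norm v * (\<Prod>v\<leftarrow>ws. norm v))"
      using Cons.prems len by (intro norm_ins_sum_le) auto
    then show "norm (ins_sum v ws G) \<le> real (Suc (length vs)) * c * norm v * (\<Prod>v\<leftarrow>ws. norm v)"
      by (simp add: len mult_ac)
  qed
  then show ?case by (simp add: mult_ac)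
qed auto

text \<open>The algebraic half of \<^const>\<open>bounded_multilinear\<close>. Isolated from the norm bound, it can be proved by
recursion on the head of the list.\<close>

definition separately_linear ::
    "nat \<Rightarrow> ('v::real_vector list \<Rightarrow> 'b::real_vector) \<Rightarrow> bool" where
  "separately_linear k m \<longleftrightarrow>
     (\<forall>vs i. length vs = k \<and> i < k \<longrightarrow> linear (\<lambda>v. m (vs[i := v])))"

lemma separately_linear_0: "separately_linear 0 m"
  by (simp add: separately_linear_def)

lemma separately_linear_Suc:
  "separately_linear (Suc k) m \<longleftrightarrow>
     (\<forall>vs. length vs = k \<longrightarrow> linear (\<lambda>v. m (v # vs))) \<and>
     (\<forall>v. separately_linear k (\<lambda>vs. m (v # vs)))"
proof (intro iffI conjI allI impI)
  assume m: "separately_linear (Suc k) m"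
  show "linear (\<lambda>v. m (v # vs))" if "length vs = k" for vs
    using m[unfolded separately_linear_def, rule_format, of "undefined # vs" 0] that by simp
  show "separately_linear k (\<lambda>vs. m (v # vs))" for v
    unfolding separately_linear_def
    using m[unfolded separately_linear_def, rule_format, of "v # _" "Suc _"] by simp
next
  assume m: "(\<forall>vs. length vs = k \<longrightarrow> linear (\<lambda>v. m (v # vs))) \<and>
     (\<forall>v. separately_linear k (\<lambda>vs. m (v # vs)))"
  show "separately_linear (Suc k) m"
    unfolding separately_linear_def
  proof (intro allI impI, elim conjE)
    fix vs :: "'a list" and i assume "length vs = Suc k" "i < Suc k"
    with m show "linear (\<lambda>v. m (vs[i := v]))"
      by (cases i) (auto simp: length_Suc_conv separately_linear_def)
  qed
qed

lemma separately_linear_add: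
  "separately_linear k m \<Longrightarrow> separately_linear k m' \<Longrightarrow> separately_linear k (\<lambda>vs. m vs + m' vs)"
  by (auto simp: separately_linear_def intro: linear_compose_add)

lemma separately_linear_ins_sum:
  "separately_linear (Suc k) G \<Longrightarrow> separately_linear k (\<lambda>us. ins_sum v us G)"
proof (induction k arbitrary: G)
  case (Suc k)
  have "linear (\<lambda>u. ins_sum v us (\<lambda>ws. G (u # ws)))" if "length us = k" for us
    using Suc.prems that by (intro linear_ins_sum_family) (simp add: separately_linear_Suc)
  then show ?case
    using Suc.prems Suc.IH
    by (auto simp: separately_linear_Suc intro!: linear_compose_add separately_linear_add)
qed (simp add: separately_linear_0)

lemma linear_ins_sum:
  "separately_linear (Suc (length us)) G \<Longrightarrow> linear (\<lambda>v. ins_sum v us G)"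
  by (induction us arbitrary: G) (auto simp: separately_linear_Suc intro!: linear_compose_add)

lemma separately_linear_sym_sum:
  "separately_linear k G \<Longrightarrow> separately_linear k (\<lambda>vs. sym_sum vs G)"
proof (induction k arbitrary: G)
  case (Suc k)
  have "linear (\<lambda>v. sym_sum vs (\<lambda>us. ins_sum v us G))" if "length vs = k" for vs
    using Suc.prems that by (intro linear_sym_sum_family linear_ins_sum) auto
  then show ?case
    using Suc.IH[OF separately_linear_ins_sum[OF Suc.prems]]
    by (auto simp: separately_linear_Suc)
qed (simp add: separately_linear_0)

section \<open>Smoothness of operator inversion\<close>

locale affine_inverse =
  fixes U :: "'v::real_normed_vector set"
    and c :: "'e::real_normed_vector \<Rightarrow>\<^sub>L 'e" and L :: "'v \<Rightarrow> 'e \<Rightarrow>\<^sub>L 'e" and R :: "'v \<Rightarrow> 'e \<Rightarrow>\<^sub>L 'e"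
  assumes open_U: "open U" and bounded_linear_L: "bounded_linear L"
    and left_inverse: "x \<in> U \<Longrightarrow> R x o\<^sub>L (c + L x) = id_blinfun"
    and right_inverse: "x \<in> U \<Longrightarrow> (c + L x) o\<^sub>L R x = id_blinfun"
begin

interpretation L: bounded_linear L by (rule bounded_linear_L)

interpretation comp: bounded_bilinear "(o\<^sub>L)" by (rule bounded_bilinear_blinfun_compose)

lemma comp_assoc: "(p o\<^sub>L q) o\<^sub>L r = p o\<^sub>L (q o\<^sub>L r)"
  by (rule blinfun_eqI) simp

lemma resolvent_identity:
  assumes x: "x \<in> U" and y: "y \<in> U"
  shows "R y - R x = - (R y o\<^sub>L L (y - x) o\<^sub>L R x)"
proof -
  have "R y o\<^sub>L L (y - x) o\<^sub>L R x = R y o\<^sub>L ((c + L y) - (c + L x)) o\<^sub>L R x"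
    by (simp add: L.diff)
  also have "\<dots> = ((R y o\<^sub>L (c + L y)) o\<^sub>L R x) - (R y o\<^sub>L ((c + L x) o\<^sub>L R x))"
    by (simp only: comp.diff_left comp.diff_right comp_assoc)
  also have "\<dots> = R x - R y"
    by (simp only: left_inverse[OF y] right_inverse[OF x]) (auto intro!: blinfun_eqI simp: blinfun.diff_left)
  finally show ?thesis by simp
qed

definition L_bound where "L_bound = (SOME K. 0 < K \<and> (\<forall>v. norm (L v) \<le> norm v * K))"

lemma L_bound_pos: "0 < L_bound" and norm_L_le: "norm (L v) \<le> L_bound * norm v"
proof -
  have "0 < L_bound \<and> (\<forall>v. norm (L v) \<le> norm v * L_bound)"
    unfolding L_bound_def using L.pos_bounded by (rule someI_ex)
  then show "0 < L_bound" "norm (L v) \<le> L_bound * norm v" by (auto simp: mult.commute)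
qed

lemma norm_comp3_le:
  assumes "norm p \<le> a" "norm q \<le> b" "norm r \<le> d" "0 \<le> a" "0 \<le> b"
  shows "norm (p o\<^sub>L q o\<^sub>L r) \<le> a * b * d"
  using assms order_trans[OF norm_blinfun_compose mult_mono[OF norm_blinfun_compose order_refl]]
  by (smt (verit, best) mult_mono mult_nonneg_nonneg norm_blinfun_compose norm_ge_zero)

text \<open>Two-sided invertibility alone makes \<open>R\<close> locally bounded: in the resolvent identity the unknown
\<open>norm (R y)\<close> appears on the right with a small factor and can be absorbed.\<close>

lemma eventually_norm_R_le:
  assumes x: "x \<in> U"
  shows "\<forall>\<^sub>F y in at x. y \<in> U \<and> norm (R y) \<le> 2 * norm (R x)"
proof -
  \<comment> \<open>Within this distance the resolvent identity gives norm (R y - R x) at most half of norm (R y).\<close>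
  define d where "d = 1 / (2 * L_bound * (norm (R x) + 1))"
  have d: "d > 0" using L_bound_pos by (simp add: d_def add_nonneg_pos)
  have "\<forall>\<^sub>F y in at x. y \<in> U"
    using open_U x eventually_at_topological by blast
  moreover have "\<forall>\<^sub>F y in at x. dist y x < d"
    using d by (auto simp: eventually_at)
  ultimately show ?thesis
  proof eventually_elim
    case (elim y)
    have "norm (R y o\<^sub>L L (y - x) o\<^sub>L R x) \<le> norm (R y) * (L_bound * norm (y - x)) * norm (R x)"
      using L_bound_pos by (intro norm_comp3_le norm_L_le) auto
    also have "\<dots> \<le> norm (R y) * (L_bound * d) * norm (R x)"
      using elim L_bound_pos by (intro mult_right_mono mult_left_mono) (auto simp: dist_norm)
    also have "\<dots> = norm (R y) * (L_bound * d * norm (R x))" by simp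
    also have "\<dots> \<le> norm (R y) * (1 / 2)"
    proof (rule mult_left_mono)
      have "L_bound * d * norm (R x) = norm (R x) / (2 * (norm (R x) + 1))"
        using L_bound_pos by (simp add: d_def)
      also have "\<dots> \<le> 1 / 2"
        by (simp add: divide_le_eq add_nonneg_pos)
      finally show "L_bound * d * norm (R x) \<le> 1 / 2" .
    qed simp
    finally have "norm (R y - R x) \<le> norm (R y) / 2"
      using resolvent_identity[OF x] elim by simp
    then show ?case using elim norm_triangle_ineq2[of "R y" "R x"] by simp
  qed
qed

text \<open>The word \<open>(-1)\<^sup>k R L(u\<^sub>1) R \<dots> L(u\<^sub>k) R\<close>. One sign goes with each letter, so that differentiating a
word becomes an insertion sum without signs.\<close>

primrec word :: "'v \<Rightarrow> 'v list \<Rightarrow> 'e \<Rightarrow>\<^sub>L 'e" where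
  "word x [] = R x"
| "word x (u # us) = - (R x o\<^sub>L L u o\<^sub>L word x us)"

lemma separately_linear_word: "separately_linear k (word x)"
proof (induction k)
  case (Suc k)
  have "linear (\<lambda>u. - (R x o\<^sub>L L u o\<^sub>L word x us))" for us
    by (rule linearI) (simp_all add: L.add L.scaleR comp.add_left comp.add_right
        comp.scaleR_left comp.scaleR_right)
  moreover have "separately_linear k (\<lambda>us. - (R x o\<^sub>L L u o\<^sub>L word x us))" for u
  proof -
    have "linear (\<lambda>w. - (R x o\<^sub>L L u o\<^sub>L w))"
      by (rule linearI) (simp_all add: comp.add_right comp.scaleR_right)
    from linear_compose[OF _ this] Suc.IH show ?thesis
      by (auto simp: separately_linear_def o_def)
  qed
  ultimately show ?case by (simp add: separately_linear_Suc)
qed (simp add: separately_linear_0)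

lemma norm_word_le:
  assumes "norm (R x) \<le> r"
  shows "norm (word x us) \<le> r * (r * L_bound) ^ length us * (\<Prod>v\<leftarrow>us. norm v)"
proof (induction us)
  case (Cons u us)
  have "0 \<le> r" using assms norm_ge_zero order_trans by blast
  then have "norm (R x o\<^sub>L L u o\<^sub>L word x us)
      \<le> r * (L_bound * norm u) * (r * (r * L_bound) ^ length us * (\<Prod>v\<leftarrow>us. norm v))"
    using assms Cons.IH L_bound_pos by (intro norm_comp3_le norm_L_le) auto
  then show ?case by (simp add: mult_ac)
qed (use assms in simp)

text \<open>A word is differentiable in \<open>x\<close> with derivative its insertion sum, and the error is quadratic,
uniformly in the letters. The induction splits off the first factor \<open>R (- L u)\<close>: by the product rule the
error consists of the error of \<open>R\<close>, the error of the shorter word, and a mixed term in which \<open>R x - R y\<close>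
meets an insertion sum; the first and the last are quadratic because \<open>R x - R y = R y L(y - x) R x\<close>.\<close>

lemma word_first_order_remainder:
  assumes r: "r \<ge> 0"
  shows "\<exists>K\<ge>0. \<forall>x\<in>U. \<forall>y\<in>U. norm (R x) \<le> r \<longrightarrow> norm (R y) \<le> r \<longrightarrow>
    (\<forall>us. length us = k \<longrightarrow>
       norm (word y us - word x us - ins_sum (y - x) us (word x))
         \<le> K * (norm (y - x))\<^sup>2 * (\<Prod>v\<leftarrow>us. norm v))"
proof (induction k)
  case 0
  have "norm (word y [] - word x [] - ins_sum (y - x) [] (word x)) \<le> r * L_bound * (r * L_bound * r) * (norm (y - x))\<^sup>2"
    if "x \<in> U" "y \<in> U" "norm (R x) \<le> r" "norm (R y) \<le> r" for x y
  proof -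
    have "word y [] - word x [] - ins_sum (y - x) [] (word x)
        = (R x - R y) o\<^sub>L L (y - x) o\<^sub>L R x"
      using resolvent_identity[OF that(1,2)] by (simp add: comp.diff_left)
    also have "R x - R y = R y o\<^sub>L L (y - x) o\<^sub>L R x"
      using resolvent_identity[OF that(1,2)] by (simp add: algebra_simps)
    also have "norm (R y o\<^sub>L L (y - x) o\<^sub>L R x o\<^sub>L L (y - x) o\<^sub>L R x)
        \<le> (r * (L_bound * norm (y - x)) * r) * (L_bound * norm (y - x)) * r"
      using that r L_bound_pos by (intro norm_comp3_le norm_L_le) auto
    finally show ?thesis by (simp add: power2_eq_square mult_ac)
  qed
  then show ?case using r L_bound_pos by (intro exI[of _ "r * L_bound * (r * L_bound * r)"]) auto
next
  case (Suc k)
  obtain K where K: "K \<ge> 0" "\<And>x y us. x \<in> U \<Longrightarrow> y \<in> U \<Longrightarrow> norm (R x) \<le> r \<Longrightarrow> norm (R y) \<le> r \<Longrightarrow>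
       length us = k \<Longrightarrow> norm (word y us - word x us - ins_sum (y - x) us (word x))
         \<le> K * (norm (y - x))\<^sup>2 * (\<Prod>v\<leftarrow>us. norm v)"
    using Suc.IH by blast
  define b where "b = r * (r * L_bound) ^ k"
  define d where "d = real (Suc k) * (r * (r * L_bound) ^ Suc k)"
  \<comment> \<open>The three summands bound the three terms of the decomposition of the error given below.\<close>
  define K' where "K' = r * L_bound * (r * L_bound * r) * L_bound * b + r * L_bound * K + r * L_bound * r * L_bound * d"
  have "norm (word y us - word x us - ins_sum (y - x) us (word x))
         \<le> K' * (norm (y - x))\<^sup>2 * (\<Prod>v\<leftarrow>us. norm v)"
    if x: "x \<in> U" and y: "y \<in> U" and rx: "norm (R x) \<le> r" and ry: "norm (R y) \<le> r"
      and len: "length us = Suc k" for x y us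
  proof -
    obtain u ws where us: "us = u # ws" and ws: "length ws = k"
      using len by (auto simp: length_Suc_conv)
    define v where "v = y - x"
    define P where "P = (\<Prod>v\<leftarrow>ws. norm v)"
    have P: "P \<ge> 0" unfolding P_def by (rule prod_list_norm_nonneg)
    define I where "I = ins_sum v ws (word x)"
    have res: "R x - R y = R y o\<^sub>L L v o\<^sub>L R x"
      using resolvent_identity[OF x y] by (simp add: v_def algebra_simps)
    have expand: "word y us - word x us - ins_sum (y - x) us (word x)
        = (((R x - R y) o\<^sub>L L v o\<^sub>L R x) o\<^sub>L (- L u) o\<^sub>L word x ws)
          + (R y o\<^sub>L (- L u) o\<^sub>L (word y ws - word x ws - I))
          + ((R x - R y) o\<^sub>L L u o\<^sub>L I)"
    proof -
      have "linear (\<lambda>w. - (R x o\<^sub>L L u o\<^sub>L w))"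
        by (rule linearI) (simp_all add: comp.add_right comp.scaleR_right)
      from ins_sum_linear[OF this, of v ws "word x"]
      have ins: "ins_sum v us (word x) = (R x o\<^sub>L L v o\<^sub>L (R x o\<^sub>L L u o\<^sub>L word x ws)) - (R x o\<^sub>L L u o\<^sub>L I)"
        by (simp add: us I_def comp.minus_right)
      have head: "(R x - R y) o\<^sub>L L v o\<^sub>L R x = (R x o\<^sub>L L v o\<^sub>L R x) - (R x - R y)"
        by (simp only: comp.diff_left res[symmetric])
      show ?thesis
        unfolding v_def[symmetric] ins head
        by (simp add: us comp.diff_left comp.diff_right comp.minus_left
            comp.minus_right comp_assoc)
    qed
    have "norm (((R x - R y) o\<^sub>L L v o\<^sub>L R x) o\<^sub>L (- L u) o\<^sub>L word x ws)
        \<le> (((r * (L_bound * norm v) * r) * (L_bound * norm v) * r) * (L_bound * norm u)) * (b * P)"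
      unfolding res b_def P_def using rx ry r L_bound_pos norm_L_le[of u] norm_word_le[OF rx, of ws]
      by (intro norm_comp3_le norm_L_le) (auto simp: ws)
    moreover have "norm (R y o\<^sub>L (- L u) o\<^sub>L (word y ws - word x ws - I))
        \<le> r * (L_bound * norm u) * (K * (norm v)\<^sup>2 * P)"
      using ry r L_bound_pos norm_L_le[of u] K(2)[OF x y rx ry ws]
      by (intro norm_comp3_le) (auto simp: I_def P_def v_def)
    moreover have "norm ((R x - R y) o\<^sub>L L u o\<^sub>L I)
        \<le> (r * (L_bound * norm v) * r) * (L_bound * norm u) * (d * (norm v * P))"
    proof -
      have "norm I \<le> real (Suc (length ws)) * (r * (r * L_bound) ^ Suc k) * (norm v * P)"
        unfolding I_def P_def using norm_word_le[OF rx] ws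
        by (intro norm_ins_sum_le) metis
      then have "norm I \<le> d * (norm v * P)" by (simp add: d_def ws)
      then show ?thesis
        unfolding res using rx ry r L_bound_pos by (intro norm_comp3_le norm_L_le) auto
    qed
    ultimately have "norm (word y us - word x us - ins_sum (y - x) us (word x))
        \<le> (((r * (L_bound * norm v) * r) * (L_bound * norm v) * r) * (L_bound * norm u)) * (b * P)
          + r * (L_bound * norm u) * (K * (norm v)\<^sup>2 * P)
          + (r * (L_bound * norm v) * r) * (L_bound * norm u) * (d * (norm v * P))"
      unfolding expand by (intro order_trans[OF norm_triangle_ineq] add_mono)
    also have "\<dots> = K' * (norm v)\<^sup>2 * (norm u * P)"
      by (simp add: K'_def power2_eq_square algebra_simps)
    finally show ?thesis by (simp add: v_def us P_def)
  qed
  moreover have "K' \<ge> 0" using r L_bound_pos K(1) by (simp add: K'_def b_def d_def)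
  ultimately show ?case by blast
qed

lemma eventually_word_remainder:
  assumes x: "x \<in> U"
  obtains K where "\<forall>\<^sub>F y in at x. \<forall>us. length us = k \<longrightarrow>
       norm (word y us - word x us - ins_sum (y - x) us (word x))
         \<le> K * (norm (y - x))\<^sup>2 * (\<Prod>v\<leftarrow>us. norm v)" "K \<ge> 0"
proof -
  obtain K where K: "K \<ge> 0" "\<And>y us. y \<in> U \<Longrightarrow> norm (R y) \<le> 2 * norm (R x) \<Longrightarrow>
       length us = k \<Longrightarrow> norm (word y us - word x us - ins_sum (y - x) us (word x))
         \<le> K * (norm (y - x))\<^sup>2 * (\<Prod>v\<leftarrow>us. norm v)"
    using word_first_order_remainder[of "2 * norm (R x)" k] x by auto
  show thesis
    using eventually_norm_R_le[OF x] K by (intro that[of K]) (auto elim!: eventually_mono)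
qed

lemma eventually_quadratic_le:
  fixes x :: 'v
  assumes "e > 0" "K \<ge> 0"
  shows "\<forall>\<^sub>F y in at x. K * (norm (y - x))\<^sup>2 \<le> e * norm (y - x)"
proof -
  have "e / (K + 1) > 0" using assms by simp
  then have "\<forall>\<^sub>F y in at x. dist y x < e / (K + 1)"
    by (auto simp: eventually_at)
  then show ?thesis
  proof eventually_elim
    case (elim y)
    then have "(K + 1) * norm (y - x) \<le> e"
      using assms by (simp add: dist_norm field_simps)
    then have "K * norm (y - x) \<le> e"
      by (smt (verit) assms(2) mult_right_mono norm_ge_zero)
    then have "K * norm (y - x) * norm (y - x) \<le> e * norm (y - x)"
      by (intro mult_right_mono) auto
    then show ?case by (simp add: power2_eq_square mult.assoc)
  qed
qed

text \<open>The symmetrized words are the derivatives: passing from \<open>vs\<close> to \<open>v # vs\<close> replaces each word by its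
insertion sum, which is its derivative in direction \<open>v\<close>.\<close>

lemma smooth_on_inverse: "smooth_on U R"
proof -
  define D where "D k x vs = sym_sum vs (word x)" for k :: nat and x vs
  have mult: "bounded_multilinear k (D k x)" for k x
  proof -
    have "separately_linear k (D k x)"
      unfolding D_def by (intro separately_linear_sym_sum separately_linear_word)
    moreover have "norm (D k x vs) \<le> fact k * (norm (R x) * (norm (R x) * L_bound) ^ k) * (\<Prod>v\<leftarrow>vs. norm v)"
      if "length vs = k" for vs
      unfolding D_def that[symmetric] by (rule norm_sym_sum_le) (metis norm_word_le order_refl)
    ultimately show ?thesis
      unfolding bounded_multilinear_def separately_linear_def by blast
  qed
  have diff: "\<forall>\<^sub>F y in at x. \<forall>vs. length vs = k \<longrightarrow>
           norm (D k y vs - D k x vs - D (Suc k) x ((y - x) # vs))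
             \<le> e * norm (y - x) * (\<Prod>v\<leftarrow>vs. norm v)"
    if x: "x \<in> U" and e: "e > 0" for x k e
  proof -
    obtain K where K: "\<forall>\<^sub>F y in at x. \<forall>us. length us = k \<longrightarrow>
       norm (word y us - word x us - ins_sum (y - x) us (word x))
         \<le> K * (norm (y - x))\<^sup>2 * (\<Prod>v\<leftarrow>us. norm v)" and K0: "K \<ge> 0"
      using eventually_word_remainder[OF x] by blast
    have "fact k * K \<ge> 0" using K0 by simp
    from K eventually_quadratic_le[OF e this, of x] show ?thesis
    proof eventually_elim
      case (elim y)
      show ?case
      proof (intro allI impI)
        fix vs :: "'v list" assume len: "length vs = k"
        have "D k y vs - D k x vs - D (Suc k) x ((y - x) # vs)
            = sym_sum vs (\<lambda>us. word y us - word x us - ins_sum (y - x) us (word x))"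
          by (simp add: D_def sym_sum_diff)
        also have "norm \<dots> \<le> fact (length vs) * (K * (norm (y - x))\<^sup>2) * (\<Prod>v\<leftarrow>vs. norm v)"
          using elim(1) len by (intro norm_sym_sum_le) auto
        also have "\<dots> \<le> e * norm (y - x) * (\<Prod>v\<leftarrow>vs. norm v)"
          using elim(2) by (intro mult_right_mono prod_list_norm_nonneg) (simp add: len mult.assoc)
        finally show "norm (D k y vs - D k x vs - D (Suc k) x ((y - x) # vs))
             \<le> e * norm (y - x) * (\<Prod>v\<leftarrow>vs. norm v)" .
      qed
    qed
  qed
  show ?thesis
    unfolding smooth_on_def using open_U mult diff by (intro conjI exI[of _ D]) (auto simp: D_def)
qed

lemma has_derivative_inverse:
  assumes x: "x \<in> U"
  shows "(R has_derivative (\<lambda>v. - (R x o\<^sub>L L v o\<^sub>L R x))) (at x)"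
proof -
  have "bounded_linear (\<lambda>v. - (R x o\<^sub>L L v o\<^sub>L R x))"
    by (intro bounded_linear_minus bounded_linear_intros bounded_linear_L)
  moreover have "\<forall>\<^sub>F y in at x. norm (R y - R x - - (R x o\<^sub>L L (y - x) o\<^sub>L R x)) \<le> e * norm (y - x)"
    if "e > 0" for e
  proof -
    obtain K where "\<forall>\<^sub>F y in at x. \<forall>us. length us = 0 \<longrightarrow>
       norm (word y us - word x us - ins_sum (y - x) us (word x))
         \<le> K * (norm (y - x))\<^sup>2 * (\<Prod>v\<leftarrow>us. norm v)" "K \<ge> 0"
      using eventually_word_remainder[OF x] by blast
    then show ?thesis
      using eventually_quadratic_le[OF that, of K x] by (auto elim: eventually_elim2)
  qed
  ultimately show ?thesis
    unfolding has_derivative_within_alt2 by auto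
qed

end

section \<open>Zero sets of functions that are affine along a complemented subspace\<close>

text \<open>Call the range of the projection \<open>P\<close> vertical. Along vertical lines \<open>h\<close> is a translation, so each
vertical slice of \<open>U\<close> contains exactly one zero of \<open>h\<close>, which makes the zero set a graph over the
kernel of \<open>P\<close>.\<close>

locale vertical_function =
  fixes U :: "'v::banach set" and P h :: "'v \<Rightarrow> 'v"
  assumes bounded_linear_P: "bounded_linear P" and P_P: "P (P x) = P x"
    and smooth_h: "smooth_on U h" and P_h: "x \<in> U \<Longrightarrow> P (h x) = h x"
    and shift_mem: "x \<in> U \<Longrightarrow> x + P v \<in> U"
    and h_shift: "x \<in> U \<Longrightarrow> h (x + P v) = h x + P v"
begin

interpretation P: bounded_linear P by (rule bounded_linear_P)

definition zeros where "zeros = {x \<in> U. h x = 0}"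

lemma open_U: "open U" using smooth_h by (simp add: smooth_on_def)

lemma retract_mem: "x \<in> U \<Longrightarrow> x - h x \<in> zeros"
  using shift_mem[of x "- h x"] h_shift[of x "- h x"] by (simp add: zeros_def P.neg P_h)

text \<open>The chart replaces the vertical part of \<open>x\<close> by \<open>h x\<close>. Since \<open>h\<close> differs from the vertical part by
a quantity that depends only on the horizontal part, which the chart preserves, subtracting the same difference again inverts it.\<close>

definition chart where "chart x = x - P x + h x"
definition chart_inv where "chart_inv x = x + P x - h x"

lemma chart_mem: "x \<in> U \<Longrightarrow> chart x \<in> U"
  using shift_mem[of x "h x - x"] by (simp add: chart_def P.diff P_h algebra_simps)

lemma chart_inv_mem: "x \<in> U \<Longrightarrow> chart_inv x \<in> U"
  using shift_mem[of x "x - h x"] by (simp add: chart_inv_def P.diff P_h algebra_simps)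

lemma chart_inv_chart: "x \<in> U \<Longrightarrow> chart_inv (chart x) = x"
  using h_shift[of x "h x - x"]
  by (simp add: chart_def chart_inv_def P.diff P.add P_h P_P algebra_simps)

lemma chart_chart_inv: "x \<in> U \<Longrightarrow> chart (chart_inv x) = x"
  using h_shift[of x "x - h x"]
  by (simp add: chart_def chart_inv_def P.diff P.add P_h P_P algebra_simps)

lemma chart_image: "chart ` U = U"
proof (intro equalityI subsetI)
  show "x \<in> chart ` U" if "x \<in> U" for x
    using imageI[OF chart_inv_mem[OF that], of chart] by (simp add: chart_chart_inv that)
qed (auto simp: chart_mem)

lemma inj_on_chart: "inj_on chart U"
  by (rule inj_on_inverseI) (rule chart_inv_chart)

lemma smooth_diffeo_on_chart: "smooth_diffeo_on U chart"
proof -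
  have "smooth_on U (\<lambda>x. (x - P x) + h x)"
    by (rule smooth_on_add[OF smooth_on_bounded_linear[OF
          bounded_linear_sub[OF bounded_linear_ident bounded_linear_P] open_U] smooth_h])
  then have 1: "smooth_on U chart" by (simp add: chart_def[abs_def])
  have "smooth_on U (\<lambda>x. - h x)"
    using smooth_on_bounded_linear_compose[OF bounded_linear_minus[OF bounded_linear_ident] smooth_h] .
  then have "smooth_on U (\<lambda>x. (x + P x) + - h x)"
    by (rule smooth_on_add[OF smooth_on_bounded_linear[OF
          bounded_linear_add[OF bounded_linear_ident bounded_linear_P] open_U]])
  then have "smooth_on U (inv_into U chart)"
  proof (rule smooth_on_cong)
    fix x assume "x \<in> U"
    then have "inv_into U chart x = chart_inv x"
      by (intro inv_into_f_eq inj_on_chart chart_inv_mem chart_chart_inv)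
    then show "inv_into U chart x = (x + P x) + - h x" by (simp add: chart_inv_def)
  qed
  with 1 show ?thesis
    by (simp add: smooth_diffeo_on_def chart_image open_U inj_on_chart)
qed

lemma chart_zeros: "chart ` (zeros \<inter> U) = {x. P x = 0} \<inter> U"
proof (intro equalityI subsetI)
  fix y assume "y \<in> chart ` (zeros \<inter> U)"
  then obtain x where x: "x \<in> U" "h x = 0" "y = chart x" by (auto simp: zeros_def)
  then have "P y = 0" by (simp add: chart_def P.diff P_P)
  with x chart_mem show "y \<in> {x. P x = 0} \<inter> U" by blast
next
  fix y assume y: "y \<in> {x. P x = 0} \<inter> U"
  then have "h (y + P (- h y)) = h y + P (- h y)" by (intro h_shift) simp
  with y have "h (chart_inv y) = 0" by (simp add: chart_inv_def P.neg P_h)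
  with y have "chart_inv y \<in> zeros \<inter> U" by (simp add: zeros_def chart_inv_mem)
  then show "y \<in> chart ` (zeros \<inter> U)"
    using y chart_chart_inv[of y] by (intro image_eqI[of y chart "chart_inv y"]) auto
qed

lemma smooth_submanifold_zeros: "smooth_submanifold zeros"
proof -
  have compl: "closed_complements {x. P x = 0} {x. P x = x}"
    unfolding closed_complements_def
  proof (intro conjI)
    show "subspace {x. P x = 0}" "subspace {x. P x = x}"
      by (auto simp: subspace_def P.add P.scaleR P.zero)
    show "closed {x. P x = 0}" "closed {x. P x = x}"
      by (intro closed_Collect_eq continuous_intros P.continuous_on)+
    show "{x. P x = 0} \<inter> {x. P x = x} = {0}" by (auto simp: P.zero)
    show "{v + w |v w. v \<in> {x. P x = 0} \<and> w \<in> {x. P x = x}} = UNIV"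
    proof -
      have "x = (x - P x) + P x \<and> P (x - P x) = 0 \<and> P (P x) = P x" for x
        by (simp add: P.diff P_P)
      then show ?thesis by blast
    qed
  qed
  have opn: "openin (top_of_set {x. P x = 0}) (chart ` (zeros \<inter> U))"
    unfolding chart_zeros using open_U by (rule openin_open_Int)
  show ?thesis
    unfolding smooth_submanifold_def
  proof (intro ballI exI conjI)
    show "X \<in> U" if "X \<in> zeros" for X using that by (simp add: zeros_def)
  qed (rule compl open_U smooth_diffeo_on_chart opn)+
qed

text \<open>A curve in the zero set has velocity in the kernel of the derivative by the chain rule. Conversely, the
retraction \<open>x \<mapsto> x - h x\<close> turns the segment \<open>X + t v\<close> into a curve in the zero set, and its velocity
\<open>v - h' X v\<close> at \<open>X\<close> equals \<open>v\<close> when \<open>h' X v = 0\<close>.\<close>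

lemma tangent_space_zeros:
  fixes h' :: "'v \<Rightarrow> 'v \<Rightarrow> 'v"
  assumes der: "\<And>x. x \<in> U \<Longrightarrow> (h has_derivative h' x) (at x)"
    and cont: "\<And>v. continuous_on U (\<lambda>x. h' x v)"
    and X: "X \<in> zeros"
  shows "tangent_space zeros X = {v. h' X v = 0}"
proof (intro equalityI subsetI)
  fix v assume "v \<in> tangent_space zeros X"
  then obtain c \<delta> where c: "v = vector_derivative c (at 0)" "\<delta> > 0"
      "c C1_differentiable_on {-\<delta><..<\<delta>}" "c ` {-\<delta><..<\<delta>} \<subseteq> zeros" "c 0 = X"
    unfolding tangent_space_def by blast
  have "(c has_vector_derivative v) (at 0)"
    using c by (simp add: C1_differentiable_on_eq flip: vector_derivative_works)
  then have "((\<lambda>t. h (c t)) has_derivative (\<lambda>t. h' X (t *\<^sub>R v))) (at 0)"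
    unfolding has_vector_derivative_def
  proof (rule has_derivative_compose)
    show "(h has_derivative h' X) (at (c 0))" using X der by (simp add: c(5) zeros_def)
  qed
  moreover have "((\<lambda>t. h (c t)) has_derivative (\<lambda>t. 0)) (at 0)"
  proof (rule has_derivative_transform_within_open[OF has_derivative_const[of 0]])
    show "0 = h (c t)" if "t \<in> {-\<delta><..<\<delta>}" for t
      using subsetD[OF c(4) imageI[OF that]] by (simp add: zeros_def)
  qed (use c(2) in auto)
  ultimately have "(\<lambda>t. h' X (t *\<^sub>R v)) = (\<lambda>t. 0)" by (rule has_derivative_unique)
  from fun_cong[OF this, of 1] show "v \<in> {v. h' X v = 0}" by simp
next
  fix v assume v: "v \<in> {v. h' X v = 0}"
  have XU: "X \<in> U" "h X = 0" using X by (auto simp: zeros_def)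
  define line where "line t = X + t *\<^sub>R v" for t :: real
  define c where "c t = line t - h (line t)" for t
  have "open (line -` U)"
    unfolding line_def by (intro open_vimage open_U continuous_intros)
  moreover have "0 \<in> line -` U" using XU by (simp add: line_def)
  ultimately obtain \<delta> where \<delta>: "\<delta> > 0" "ball 0 \<delta> \<subseteq> line -` U" by (rule openE)
  have lU: "line t \<in> U" if "t \<in> {-\<delta><..<\<delta>}" for t
    using that subsetD[OF \<delta>(2), of t] by (simp add: dist_norm abs_less_iff)
  have dc: "(c has_vector_derivative (v - h' (line t) v)) (at t)" if "t \<in> {-\<delta><..<\<delta>}" for t
  proof -
    have dl: "(line has_derivative (\<lambda>s. s *\<^sub>R v)) (at t)"
      unfolding line_def by (auto intro!: derivative_eq_intros)
    have "(c has_derivative (\<lambda>s. s *\<^sub>R v - h' (line t) (s *\<^sub>R v))) (at t)"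
      unfolding c_def[abs_def] 
      by (rule has_derivative_diff[OF dl has_derivative_compose[OF dl der[OF lU[OF that]]]])
    then show ?thesis
      using linear_scale[OF has_derivative_linear[OF der[OF lU[OF that]]]]
      by (simp add: has_vector_derivative_def scaleR_diff_right)
  qed
  have "continuous_on {-\<delta><..<\<delta>} (\<lambda>t. v - h' (line t) v)"
  proof (intro continuous_on_diff continuous_on_const continuous_on_compose2[OF cont])
    show "continuous_on {-\<delta><..<\<delta>} line" unfolding line_def by (intro continuous_intros)
  qed (intro image_subsetI lU)
  then have "c C1_differentiable_on {-\<delta><..<\<delta>}"
    unfolding C1_differentiable_on_def
    by (intro exI[of _ "\<lambda>t. v - h' (line t) v"] conjI ballI dc)
  moreover have "c ` {-\<delta><..<\<delta>} \<subseteq> zeros"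
    unfolding c_def by (intro image_subsetI retract_mem lU)
  moreover have "c 0 = X" using XU by (simp add: c_def line_def)
  moreover have "v = vector_derivative c (at 0)"
    using vector_derivative_at[OF dc[of 0]] v \<delta>(1) by (simp add: line_def)
  ultimately show "v \<in> tangent_space zeros X"
    unfolding tangent_space_def using \<delta>(1)
    by (intro CollectI exI[of _ c] exI[of _ \<delta>] conjI)
qed

end

section \<open>The Schur complement relative to a generalized inverse\<close>

locale generalized_inverse =
  fixes A :: "'a::banach \<Rightarrow>\<^sub>L 'b::banach" and B :: "'b \<Rightarrow>\<^sub>L 'a"
  assumes A_B_A: "A (B (A x)) = A x" and B_A_B: "B (A (B y)) = B y"
begin

text \<open>The projection onto \<open>N(A)\<close> along \<open>R(B)\<close>, and the projection onto \<open>N(B)\<close> along \<open>R(A)\<close>.\<close>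

definition P where "P = id_blinfun - (B o\<^sub>L A)"
definition Q where "Q = id_blinfun - (A o\<^sub>L B)"

lemma P_apply: "P x = x - B (A x)" by (simp add: P_def blinfun.diff_left)
lemma Q_apply: "Q y = y - A (B y)" by (simp add: Q_def blinfun.diff_left)

text \<open>The condition involves only \<open>B T\<close>, that is, the first row of the block matrix of \<open>T\<close>. This makes the
neighbourhood invariant under changes of the (2,2) corner, which a ball around \<open>A\<close> in general is not.\<close>

definition nbhd where "nbhd = {T. norm (B o\<^sub>L (T - A)) < 1}"

text \<open>In block form \<open>1 + B (T - A)\<close> has first row \<open>A\<^sub>1\<^sub>1\<^sup>-\<^sup>1 T\<^sub>1\<^sub>1, A\<^sub>1\<^sub>1\<^sup>-\<^sup>1 T\<^sub>1\<^sub>2\<close> and second row \<open>0, 1\<close>, so its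
inverse maps \<open>n \<in> N(A)\<close> to \<open>n - T\<^sub>1\<^sub>1\<^sup>-\<^sup>1 T\<^sub>1\<^sub>2 n\<close>.\<close>

definition resolvent where "resolvent T =
    (SOME S. S o\<^sub>L (id_blinfun + (B o\<^sub>L (T - A))) = id_blinfun \<and>
      (id_blinfun + (B o\<^sub>L (T - A))) o\<^sub>L S = id_blinfun)"

text \<open>By the block form of the resolvent this is \<open>T\<^sub>2\<^sub>2 - T\<^sub>2\<^sub>1 T\<^sub>1\<^sub>1\<^sup>-\<^sup>1 T\<^sub>1\<^sub>2\<close>, extended by zero to the whole space.\<close>

definition schur where "schur T = Q o\<^sub>L (T o\<^sub>L resolvent T) o\<^sub>L P"

definition corner where "corner T = Q o\<^sub>L T o\<^sub>L P"

text \<open>The product rule applied to \<open>T \<cdot> resolvent T\<close>.\<close>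

definition schur_deriv where "schur_deriv T H =
    Q o\<^sub>L ((H o\<^sub>L resolvent T) - (T o\<^sub>L (resolvent T o\<^sub>L (B o\<^sub>L H) o\<^sub>L resolvent T))) o\<^sub>L P"

lemma resolvent_inverse:
  assumes "T \<in> nbhd"
  shows "resolvent T o\<^sub>L (id_blinfun + (B o\<^sub>L (T - A))) = id_blinfun"
    "(id_blinfun + (B o\<^sub>L (T - A))) o\<^sub>L resolvent T = id_blinfun"
proof -
  have "norm (B o\<^sub>L (T - A)) < 1" using assms by (simp add: nbhd_def)
  then obtain S where "S o\<^sub>L (id_blinfun + (B o\<^sub>L (T - A))) = id_blinfun"
    "(id_blinfun + (B o\<^sub>L (T - A))) o\<^sub>L S = id_blinfun"
    by (rule inverse_near_identity)
  then have "\<exists>S. S o\<^sub>L (id_blinfun + (B o\<^sub>L (T - A))) = id_blinfun \<and>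
    (id_blinfun + (B o\<^sub>L (T - A))) o\<^sub>L S = id_blinfun"
    by (intro exI[of _ S] conjI)
  note inv = someI_ex[OF this, folded resolvent_def]
  show "resolvent T o\<^sub>L (id_blinfun + (B o\<^sub>L (T - A))) = id_blinfun" using inv by (rule conjunct1)
  show "(id_blinfun + (B o\<^sub>L (T - A))) o\<^sub>L resolvent T = id_blinfun" using inv by (rule conjunct2)
qed

lemma Z_apply: "(id_blinfun + (B o\<^sub>L (T - A))) x = P x + B (T x)"
  by (simp add: P_apply blinfun.bilinear_simps)

lemma resolvent_left: "T \<in> nbhd \<Longrightarrow> resolvent T (P x + B (T x)) = x"
  by (metis resolvent_inverse(1) Z_apply blinfun_apply_blinfun_compose blinfun_apply_id_blinfun)

lemma resolvent_right: "T \<in> nbhd \<Longrightarrow> P (resolvent T x) + B (T (resolvent T x)) = x"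
  by (metis resolvent_inverse(2) Z_apply blinfun_apply_blinfun_compose blinfun_apply_id_blinfun)

lemma P_P: "P (P x) = P x" by (simp add: P_apply blinfun.diff_right A_B_A)
lemma Q_Q: "Q (Q y) = Q y" by (simp add: Q_apply blinfun.diff_right A_B_A)
lemma P_B: "P (B y) = 0" by (simp add: P_apply B_A_B)
lemma B_Q: "B (Q y) = 0" by (simp add: Q_apply blinfun.diff_right B_A_B)

lemma P_resolvent: "T \<in> nbhd \<Longrightarrow> P (resolvent T x) = P x"
  by (metis resolvent_right P_P P_B add_0_right blinfun.add_right)

lemma open_nbhd: "open nbhd"
  unfolding nbhd_def by (intro open_Collect_less continuous_intros)

lemma A_mem: "A \<in> nbhd" by (simp add: nbhd_def)

lemma bounded_linear_corner: "bounded_linear corner"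
  unfolding corner_def[abs_def] by (intro bounded_linear_intros)

lemma B_corner: "B o\<^sub>L (T + corner D - A) = B o\<^sub>L (T - A)"
  by (rule blinfun_eqI) (simp add: blinfun.bilinear_simps corner_def B_Q)

lemma resolvent_shift: "resolvent (T + corner D) = resolvent T" by (simp add: resolvent_def B_corner)

lemma affine_inverse_resolvent: "affine_inverse nbhd (id_blinfun - (B o\<^sub>L A)) (\<lambda>T. B o\<^sub>L T) resolvent"
proof (rule affine_inverse.intro)
  fix T assume T: "T \<in> nbhd"
  have eq: "id_blinfun - (B o\<^sub>L A) + (B o\<^sub>L T) = id_blinfun + (B o\<^sub>L (T - A))"
    by (rule blinfun_eqI) (simp add: blinfun.bilinear_simps)
  show "resolvent T o\<^sub>L (id_blinfun - (B o\<^sub>L A) + (B o\<^sub>L T)) = id_blinfun"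
    "(id_blinfun - (B o\<^sub>L A) + (B o\<^sub>L T)) o\<^sub>L resolvent T = id_blinfun"
    unfolding eq by (rule resolvent_inverse[OF T])+
qed (intro open_nbhd bounded_linear_intros)+

text \<open>The Schur complement contains the product of \<open>T\<close> with its resolvent. To obtain its smoothness from that
of inversion alone, both are read off from the inverse of the operator on \<open>F \<times> E\<close> that sends
\<open>(y, x)\<close> to \<open>(y - (T - A) x, x + B (T - A) x)\<close>. It equals \<open>1 + J (T - A) snd\<close>, hence is affine in \<open>T\<close>.\<close>

definition J :: "'b \<Rightarrow>\<^sub>L ('b \<times> 'a)" where "J = Blinfun (\<lambda>y. (- y, B y))"

lemma J_apply: "J y = (- y, B y)"
  unfolding J_def by (subst bounded_linear_Blinfun_apply)
    (intro bounded_linear_Pair bounded_linear_minus bounded_linear_ident blinfun.bounded_linear_right, simp)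

definition inr :: "'a \<Rightarrow>\<^sub>L ('b \<times> 'a)" where "inr = Blinfun (\<lambda>x. (0, x))"

lemma inr_apply: "inr x = (0, x)"
  unfolding inr_def by (subst bounded_linear_Blinfun_apply)
    (intro bounded_linear_Pair bounded_linear_zero bounded_linear_ident, simp)

text \<open>The push-through (Woodbury) formula for the inverse of \<open>1 + J (T - A) snd\<close>: it reduces inversion on
\<open>F \<times> E\<close> to inversion of \<open>1 + (snd J) (T - A) = 1 + B (T - A)\<close> on \<open>E\<close>.\<close>

definition block_resolvent where
  "block_resolvent T = id_blinfun - (J o\<^sub>L (T - A) o\<^sub>L resolvent T o\<^sub>L snd_blinfun)"

lemma affine_inverse_block:
  "affine_inverse nbhd (id_blinfun - (J o\<^sub>L A o\<^sub>L snd_blinfun)) (\<lambda>T. J o\<^sub>L T o\<^sub>L snd_blinfun) block_resolvent"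
proof (rule affine_inverse.intro)
  fix T assume T: "T \<in> nbhd"
  have M: "(id_blinfun - (J o\<^sub>L A o\<^sub>L snd_blinfun) + (J o\<^sub>L T o\<^sub>L snd_blinfun)) z
      = (fst z - (T - A) (snd z), snd z + B ((T - A) (snd z)))" for z
    by (simp add: J_apply blinfun.bilinear_simps prod_eq_iff)
  have N: "block_resolvent T z = (fst z + (T - A) (resolvent T (snd z)), snd z - B ((T - A) (resolvent T (snd z))))" for z
    by (simp add: block_resolvent_def J_apply blinfun.bilinear_simps prod_eq_iff)
  have K: "P x + B (T x) = x + B ((T - A) x)" for x
    by (simp add: P_apply blinfun.bilinear_simps)
  have l: "resolvent T (x + B ((T - A) x)) = x" and r: "resolvent T x + B ((T - A) (resolvent T x)) = x" for x
    using resolvent_left[OF T, of x] resolvent_right[OF T, of x] by (simp_all only: K)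
  from r have r': "x - B ((T - A) (resolvent T x)) = resolvent T x" for x
    by (metis add_diff_cancel_right')
  show "block_resolvent T o\<^sub>L (id_blinfun - (J o\<^sub>L A o\<^sub>L snd_blinfun) + (J o\<^sub>L T o\<^sub>L snd_blinfun)) = id_blinfun"
    by (rule blinfun_eqI) (simp add: M N l)
  show "(id_blinfun - (J o\<^sub>L A o\<^sub>L snd_blinfun) + (J o\<^sub>L T o\<^sub>L snd_blinfun)) o\<^sub>L block_resolvent T = id_blinfun"
    by (rule blinfun_eqI) (simp add: M N r r')
qed (intro open_nbhd bounded_linear_intros)+

text \<open>The corner of the block inverse is \<open>(T - A) (resolvent T)\<close>; the term with \<open>A\<close> disappears since \<open>Q A = 0\<close>.\<close>

lemma schur_eq_block: "schur T = Q o\<^sub>L (fst_blinfun o\<^sub>L block_resolvent T o\<^sub>L inr) o\<^sub>L P"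
  by (rule blinfun_eqI)
    (simp add: schur_def block_resolvent_def J_apply inr_apply blinfun.bilinear_simps Q_apply A_B_A)

lemma smooth_on_schur: "smooth_on nbhd schur"
proof -
  have "bounded_linear (\<lambda>S. Q o\<^sub>L (fst_blinfun o\<^sub>L S o\<^sub>L inr) o\<^sub>L P)"
    by (intro bounded_linear_intros)
  from smooth_on_bounded_linear_compose[OF this affine_inverse.smooth_on_inverse[OF affine_inverse_block]]
  show ?thesis by (simp add: schur_eq_block[abs_def])
qed

lemma schur_has_derivative:
  assumes "T \<in> nbhd"
  shows "(schur has_derivative schur_deriv T) (at T)"
proof -
  have "bounded_linear (\<lambda>S. Q o\<^sub>L S o\<^sub>L P)" by (intro bounded_linear_intros)
  from bounded_linear.has_derivative[OF this bounded_bilinear.FDERIV[OF bounded_bilinear_blinfun_compose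
      has_derivative_ident affine_inverse.has_derivative_inverse[OF affine_inverse_resolvent assms]]]
  have "(schur has_derivative (\<lambda>H. Q o\<^sub>L ((T o\<^sub>L - (resolvent T o\<^sub>L (B o\<^sub>L H) o\<^sub>L resolvent T)) + (H o\<^sub>L resolvent T)) o\<^sub>L P)) (at T)"
    unfolding schur_def[abs_def] .
  moreover have "Q o\<^sub>L ((T o\<^sub>L - (resolvent T o\<^sub>L (B o\<^sub>L H) o\<^sub>L resolvent T)) + (H o\<^sub>L resolvent T)) o\<^sub>L P = schur_deriv T H" for H
    by (rule blinfun_eqI) (simp add: schur_deriv_def blinfun.bilinear_simps)
  ultimately show ?thesis by simp
qed

lemma continuous_schur_deriv: "continuous_on nbhd (\<lambda>T. schur_deriv T H)"
proof -
  have "continuous_on nbhd resolvent"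
    using has_derivative_continuous[OF affine_inverse.has_derivative_inverse[OF affine_inverse_resolvent]]
    by (intro continuous_at_imp_continuous_on ballI)
  then show ?thesis unfolding schur_deriv_def by (intro continuous_intros)
qed

sublocale vertical: vertical_function nbhd corner schur
proof (rule vertical_function.intro)
  show "bounded_linear corner" by (rule bounded_linear_corner)
  show "corner (corner T) = corner T" for T
    by (rule blinfun_eqI) (simp add: corner_def P_P Q_Q)
  show "smooth_on nbhd schur" by (rule smooth_on_schur)
  show "corner (schur T) = schur T" for T by (rule blinfun_eqI) (simp add: corner_def schur_def P_P Q_Q)
  show "T + corner D \<in> nbhd" if "T \<in> nbhd" for T D using that by (simp add: nbhd_def B_corner)
  show "schur (T + corner D) = schur T + corner D" if "T \<in> nbhd" for T D
    by (rule blinfun_eqI)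
      (simp add: schur_def resolvent_shift, simp add: corner_def blinfun.bilinear_simps P_resolvent[OF that] P_P Q_Q)
qed

lemma A_mem_zeros: "A \<in> vertical.zeros"
proof -
  have "Q (A x) = 0" for x by (simp add: Q_apply A_B_A)
  then have "schur A = 0" by (auto intro!: blinfun_eqI simp: schur_def)
  then show ?thesis by (simp add: vertical.zeros_def A_mem)
qed

context
  fixes X assumes X: "X \<in> vertical.zeros"
begin

lemma X_mem: "X \<in> nbhd" and Q_X: "Q (X (resolvent X (P x))) = 0"
proof -
  show "X \<in> nbhd" using X by (simp add: vertical.zeros_def)
  have "schur X x = 0" using X by (simp add: vertical.zeros_def)
  then show "Q (X (resolvent X (P x))) = 0" by (simp add: schur_def)
qed

text \<open>The Schur complement sees only the component of this vector in \<open>N(B)\<close>; the component in \<open>R(A)\<close> vanishes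
for every operator of the neighbourhood, by the definition of the resolvent.\<close>

lemma X_resolvent_P: "X (resolvent X (P x)) = 0"
proof -
  have "B (X (resolvent X (P x))) = 0"
    using resolvent_right[OF X_mem, of "P x"] by (simp add: P_resolvent[OF X_mem] P_P)
  then show ?thesis using Q_X[of x] by (simp add: Q_apply)
qed

lemma null_space_X: "null_space X = range (\<lambda>x. resolvent X (P x))"
proof -
  have "x = resolvent X (P x)" if "X x = 0" for x
    using resolvent_left[OF X_mem, of x] that by simp
  then show ?thesis by (auto simp: null_space_def X_resolvent_P)
qed

text \<open>By construction of the resolvent \<open>y\<close> and \<open>X (resolvent X (B y))\<close> always have the same component in
\<open>R(A)\<close>, so \<open>y\<close> lies in the range as soon as their components in \<open>N(B)\<close> agree. Conversely, for \<open>y = X x\<close>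
the vectors \<open>x\<close> and \<open>resolvent X (B y)\<close> differ by an element of \<open>N(X)\<close>.\<close>

lemma range_space_X: "y \<in> range_space X \<longleftrightarrow> Q (y - X (resolvent X (B y))) = 0"
proof
  assume "y \<in> range_space X"
  then obtain x where y: "y = X x" by (auto simp: range_space_def)
  have "x = resolvent X (P x) + resolvent X (B (X x))"
    using resolvent_left[OF X_mem, of x] by (simp add: blinfun.add_right)
  then have "X x = X (resolvent X (P x)) + X (resolvent X (B (X x)))" by (metis blinfun.add_right)
  then show "Q (y - X (resolvent X (B y))) = 0" by (simp add: y X_resolvent_P)
next
  assume Q0: "Q (y - X (resolvent X (B y))) = 0"
  have "B (X (resolvent X (B y))) = B y"
    using resolvent_right[OF X_mem, of "B y"] by (simp add: P_resolvent[OF X_mem] P_B)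
  with Q0 have "y = X (resolvent X (B y))" by (simp add: Q_apply blinfun.diff_right)
  then show "y \<in> range_space X" by (metis rangeI range_space_def)
qed

text \<open>By the description of \<open>N(X)\<close> and \<open>R(X)\<close>, the equation \<open>schur_deriv X H = 0\<close>, evaluated at \<open>x\<close>, says that
\<open>H\<close> maps the element \<open>resolvent X (P x)\<close> of \<open>N(X)\<close> into \<open>R(X)\<close>.\<close>

lemma tangent_space_X: "tangent_space vertical.zeros X = operator_family X"
proof -
  have "schur_deriv X H x = Q (H (resolvent X (P x)) - X (resolvent X (B (H (resolvent X (P x))))))" for H x
    by (simp add: schur_deriv_def blinfun.diff_left)
  then have "schur_deriv X H x = 0 \<longleftrightarrow> H (resolvent X (P x)) \<in> range_space X" for H x
    by (simp add: range_space_X)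
  moreover have "schur_deriv X H = 0 \<longleftrightarrow> (\<forall>x. schur_deriv X H x = 0)" for H
    by (auto intro: blinfun_eqI)
  ultimately show ?thesis
    using vertical.tangent_space_zeros[OF schur_has_derivative continuous_schur_deriv X]
    by (auto simp: operator_family_def null_space_X)
qed

end

end

section \<open>Smooth integrability\<close>

theorem theorem4p1:
  fixes A :: "'a::banach \<Rightarrow>\<^sub>L 'b::banach"
  assumes "A \<noteq> 0"
    and "double_split A"
  shows "smoothly_integrable_at operator_family A"
proof -
  obtain B where "A o\<^sub>L B o\<^sub>L A = A" "B o\<^sub>L A o\<^sub>L B = B"
    using double_split_generalized_inverse[OF assms(2)] .
  then interpret generalized_inverse A B
    by unfold_locales (metis blinfun_apply_blinfun_compose)+
  show ?thesis
    unfolding smoothly_integrable_at_def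
    using vertical.smooth_submanifold_zeros A_mem_zeros tangent_space_X by blast
qed

end
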